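(* Let $\mathcal F$ denote a field, and let $(A,A^* )$ denote a Leonard pair over $\mathcal F$. Then there exists a sequence of scalars $\beta,\gamma,\gamma^*,\varrho,\varrho^*$ taken from $\mathcal F$ such that both $$0=[A,\;A^2A^*-\beta AA^*A+A^*A^2-\gamma(AA^*+A^*A)-\varrho A^*],$$ $$0=[A^*,\;A^{*2}A-\beta A^*AA^*+AA^{*2}-\gamma^*(A^*A+AA^* )-\varrho^*A],$$ where $[r,s]$ means $rs-sr$. The sequence is uniquely determined by the Leonard pair if the diameter is at least $3$.
   Context: Let $d$ be a nonnegative integer and $\mathcal A$ an $\mathcal F$-algebra isomorphic to $\mathrm{Mat}_{d+1}(\mathcal F)$. An element of $\mathcal A$ is multiplicity-free if it has $d+1$ distinct eigenvalues (roots of its minimal polynomial), all in $\mathcal F$. If $A\in\mathcal A$ is multiplicity-free with eigenvalues $\theta_0,\ldots,\theta_d$, the primitive idempotent of $A$ associated with $\theta_i$ is $E_i=\prod_{j\neq i}(A-\theta_jI)/(\theta_i-\theta_j)$. A Leonard pair in $\mathcal A$ is an ordered pair $(A,A^* )$ of multiplicity-free elements of $\mathcal A$ ($A^*$ is just another element, not a conjugate-transpose) for which there exist an ordering $E_0,\ldots,E_d$ of the primitive idempotents of $A$ and an ordering $E^*_0,\ldots,E^*_d$ of the primitive idempotents of $A^*$ such that, for $0\le i,j\le d$, both $E_iA^*E_j$ and $E^*_iAE^*_j$ are $0$ if $|i-j|>1$ and are nonzero if $|i-j|=1$. The integer $d$ is called the diameter of the pair, and the pair is said to be over $\mathcal F$.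 (Equivalently, $A$ and $A^*$ are linear transformations of a $(d+1)$-dimensional $\mathcal F$-vector space $V$ such that $V$ has a basis in which $A^*$ is diagonal and $A$ is irreducible tridiagonal, and a basis in which $A$ is diagonal and $A^*$ is irreducible tridiagonal; irreducible means all entries immediately above and below the main diagonal are nonzero.) *)

theory Defs
  imports
    "HOL-Computational_Algebra.Polynomial"
    "Jordan_Normal_Form.Matrix"
begin

text \<open>An associative unital algebra over a field, with scalar multiplication given explicitly
  so that the field of scalars is arbitrary.\<close>

locale field_algebra = vector_space scale
  for scale :: "'f::field \<Rightarrow> 'a::ring_1 \<Rightarrow> 'a" +
  assumes scale_mult_left: "scale c x * y = scale c (x * y)"
    and scale_mult_right: "x * scale c y = scale c (x * y)"

locale matrix_algebra = field_algebra scale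
  for scale :: "'f::field \<Rightarrow> 'a::ring_1 \<Rightarrow> 'a" +
  fixes d :: nat
  assumes iso_Mat: "\<exists>\<phi> :: 'a \<Rightarrow> 'f mat.
    bij_betw \<phi> UNIV (carrier_mat (d + 1) (d + 1)) \<and>
    \<phi> 1 = 1\<^sub>m (d + 1) \<and>
    (\<forall>x y. \<phi> (x + y) = \<phi> x + \<phi> y) \<and>
    (\<forall>x y. \<phi> (x * y) = \<phi> x * \<phi> y) \<and>
    (\<forall>c x. \<phi> (scale c x) = c \<cdot>\<^sub>m \<phi> x)"

definition poly_at :: "('f::field \<Rightarrow> 'a::ring_1 \<Rightarrow> 'a) \<Rightarrow> 'f poly \<Rightarrow> 'a \<Rightarrow> 'a" where
  "poly_at scale p x = (\<Sum>i\<le>degree p. scale (coeff p i) (x ^ i))"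

definition is_minimal_poly :: "('f::field \<Rightarrow> 'a::ring_1 \<Rightarrow> 'a) \<Rightarrow> 'a \<Rightarrow> 'f poly \<Rightarrow> bool" where
  "is_minimal_poly scale x p \<longleftrightarrow>
     lead_coeff p = 1 \<and> poly_at scale p x = 0 \<and>
     (\<forall>q. q \<noteq> 0 \<and> poly_at scale q x = 0 \<longrightarrow> degree p \<le> degree q)"

definition eigenvalues :: "('f::field \<Rightarrow> 'a::ring_1 \<Rightarrow> 'a) \<Rightarrow> 'a \<Rightarrow> 'f set" where
  "eigenvalues scale x = {\<theta>. \<exists>p. is_minimal_poly scale x p \<and> poly p \<theta> = 0}"

text \<open>Only roots in the ground field are counted. In an algebra of (d+1) by (d+1) matrices the
  minimal polynomial has degree at most \<open>d + 1\<close>, so having \<open>d + 1\<close> of its roots in the field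
  means that all its roots lie in the field.\<close>

definition multiplicity_free ::
  "('f::field \<Rightarrow> 'a::ring_1 \<Rightarrow> 'a) \<Rightarrow> nat \<Rightarrow> 'a \<Rightarrow> bool" where
  "multiplicity_free scale d x \<longleftrightarrow> card (eigenvalues scale x) = d + 1"

text \<open>The algebra is not commutative, so the product is taken over a list; its factors commute
  with each other, so the order in which they are listed is immaterial.\<close>

definition primitive_idempotent ::
  "('f::field \<Rightarrow> 'a::ring_1 \<Rightarrow> 'a) \<Rightarrow> nat \<Rightarrow> 'a \<Rightarrow> (nat \<Rightarrow> 'f) \<Rightarrow> nat \<Rightarrow> 'a" where
  "primitive_idempotent scale d x \<theta> i =
     prod_list (map (\<lambda>j. scale (1 / (\<theta> i - \<theta> j)) (x - scale (\<theta> j) 1))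
       (filter (\<lambda>j. j \<noteq> i) [0..<d + 1]))"

text \<open>An ordering of the primitive idempotents is the one induced by an ordering
  \<open>\<theta> 0, \<dots>, \<theta> d\<close> of the eigenvalues.\<close>

definition primitive_idempotent_ordering ::
  "('f::field \<Rightarrow> 'a::ring_1 \<Rightarrow> 'a) \<Rightarrow> nat \<Rightarrow> 'a \<Rightarrow> (nat \<Rightarrow> 'a) \<Rightarrow> bool" where
  "primitive_idempotent_ordering scale d x E \<longleftrightarrow>
     (\<exists>\<theta>. bij_betw \<theta> {0..d} (eigenvalues scale x) \<and>
          (\<forall>i\<le>d. E i = primitive_idempotent scale d x \<theta> i))"

definition leonard_pair ::
  "('f::field \<Rightarrow> 'a::ring_1 \<Rightarrow> 'a) \<Rightarrow> nat \<Rightarrow> 'a \<Rightarrow> 'a \<Rightarrow> bool" where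
  "leonard_pair scale d A As \<longleftrightarrow>
     multiplicity_free scale d A \<and> multiplicity_free scale d As \<and>
     (\<exists>E Es. primitive_idempotent_ordering scale d A E \<and>
             primitive_idempotent_ordering scale d As Es \<and>
             (\<forall>i\<le>d. \<forall>j\<le>d.
                (\<bar>int i - int j\<bar> > 1 \<longrightarrow> E i * As * E j = 0 \<and> Es i * A * Es j = 0) \<and>
                (\<bar>int i - int j\<bar> = 1 \<longrightarrow> E i * As * E j \<noteq> 0 \<and> Es i * A * Es j \<noteq> 0)))"

definition commutator :: "'a::ring_1 \<Rightarrow> 'a \<Rightarrow> 'a" where
  "commutator r s = r * s - s * r"

definition tridiagonal_relations ::
  "('f::field \<Rightarrow> 'a::ring_1 \<Rightarrow> 'a) \<Rightarrow> 'a \<Rightarrow> 'a \<Rightarrow> 'f \<Rightarrow> 'f \<Rightarrow> 'f \<Rightarrow> 'f \<Rightarrow> 'f \<Rightarrow> bool" where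
  "tridiagonal_relations scale A As \<beta> \<gamma> \<gamma>s \<rho> \<rho>s \<longleftrightarrow>
     0 = commutator A
           (A^2 * As - scale \<beta> (A * As * A) + As * A^2
              - scale \<gamma> (A * As + As * A) - scale \<rho> As) \<and>
     0 = commutator As
           (As^2 * A - scale \<beta> (As * A * As) + A * As^2
              - scale \<gamma>s (As * A + A * As) - scale \<rho>s A)"

end

theory Submission
  imports Defs "Jordan_Normal_Form.Determinant"
begin

text \<open>Sandwiching the first relation between primitive idempotents of \<open>A\<close> turns it into the scalar
  conditions \<open>P (\<theta>\<^sub>i, \<theta>\<^sub>i\<^sub>+\<^sub>1) = 0\<close> for
  \<open>P (x, y) = x\<^sup>2 - \<beta> x y + y\<^sup>2 - \<gamma> (x + y) - \<rho>\<close>; subtracting consecutive conditions shows that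
  they determine the parameters when \<open>d \<ge> 3\<close>, in particular
  \<open>\<beta> + 1 = (\<theta>\<^sub>0 - \<theta>\<^sub>3) / (\<theta>\<^sub>1 - \<theta>\<^sub>2)\<close>.
  For existence, tridiagonality lets one write \<open>A\<^sup>2 A* A - A A* A\<^sup>2 = [p(A), A*]\<close> for a polynomial \<open>p\<close>
  of degree at most \<open>d\<close>. Sandwiching between \<open>E*\<^sub>n\<close> and \<open>E*\<^sub>0\<close> shows that \<open>p\<close> has degree at most 3,
  with \<open>p\<^sub>3 = (\<theta>*\<^sub>1 - \<theta>*\<^sub>2) / (\<theta>*\<^sub>0 - \<theta>*\<^sub>3)\<close>, and dividing by \<open>p\<^sub>3\<close> solves the first relation with
  \<open>\<beta> + 1 = 1 / p\<^sub>3\<close>. By the formula for \<open>\<beta>\<close> above, the dual argument yields the same \<open>\<beta>\<close>.\<close>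

section \<open>Polynomials in an algebra element\<close>

context field_algebra
begin

text \<open>Padding the defining sum to a common length lets polynomials of different degrees be
  combined coefficientwise.\<close>

lemma poly_at_eq_sum:
  assumes "degree p \<le> n"
  shows "poly_at scale p x = (\<Sum>i\<le>n. scale (coeff p i) (x ^ i))"
  unfolding poly_at_def
  by (rule sum.mono_neutral_left) (use assms in \<open>auto simp: coeff_eq_0\<close>)

lemma poly_at_diff: "poly_at scale (p - q) x = poly_at scale p x - poly_at scale q x"
proof -
  let ?n = "max (degree p) (degree q)"
  have "degree (p - q) \<le> ?n" by (rule degree_diff_le_max)
  then show ?thesis
    by (simp add: poly_at_eq_sum[where n = ?n] scale_left_diff_distrib sum_subtractf)
qed

lemma poly_at_smult: "poly_at scale (Polynomial.smult c p) x = scale c (poly_at scale p x)"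
  by (simp add: poly_at_eq_sum[where n = "degree p"] degree_smult_le scale_sum_right)

lemma poly_at_pCons_0: "poly_at scale (pCons 0 p) x = x * poly_at scale p x"
proof -
  have "degree (pCons 0 p) \<le> Suc (degree p)" by (rule degree_pCons_le)
  then have "poly_at scale (pCons 0 p) x =
      (\<Sum>i\<le>Suc (degree p). scale (coeff (pCons 0 p) i) (x ^ i))"
    by (rule poly_at_eq_sum)
  also have "\<dots> = (\<Sum>i\<le>degree p. scale (coeff p i) (x ^ Suc i))"
    by (simp only: sum.atMost_Suc_shift coeff_pCons_0 coeff_pCons_Suc scale_zero_left add_0_left)
  also have "\<dots> = x * poly_at scale p x"
    by (simp add: poly_at_def sum_distrib_left scale_mult_right)
  finally show ?thesis .
qed

lemma poly_at_linear_mult: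
  "poly_at scale ([:- a, 1:] * p) x = (x - scale a 1) * poly_at scale p x"
proof -
  have "[:- a, 1:] * p = pCons 0 p - Polynomial.smult a p" by simp
  then show ?thesis
    by (simp only: poly_at_diff poly_at_pCons_0 poly_at_smult left_diff_distrib scale_mult_left
        mult_1_left)
qed

text \<open>Split the minimal polynomial as \<open>(X - a) q\<close>. By minimality \<open>q\<close>
  does not annihilate \<open>x\<close>, so its value at \<open>x\<close> can serve as
  \<open>y\<close>, which stands in for an eigenvector.\<close>

lemma eigenvalue_annihilates:
  assumes "a \<in> eigenvalues scale x"
  obtains y where "y \<noteq> 0" "(x - scale a 1) * y = 0"
proof -
  from assms obtain p where p: "is_minimal_poly scale x p" "poly p a = 0"
    by (auto simp: eigenvalues_def)
  then have "[:- a, 1:] dvd p" by (simp add: poly_eq_0_iff_dvd)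
  then obtain q where q: "p = [:- a, 1:] * q" by (auto elim: dvdE)
  have "p \<noteq> 0" using p by (auto simp: is_minimal_poly_def)
  then have "q \<noteq> 0" using q by auto
  then have "degree p = Suc (degree q)" unfolding q by (subst degree_mult_eq) auto
  then have "poly_at scale q x \<noteq> 0"
    using p(1) \<open>q \<noteq> 0\<close> by (auto simp: is_minimal_poly_def)
  moreover have "(x - scale a 1) * poly_at scale q x = 0"
    using p(1) unfolding is_minimal_poly_def q poly_at_linear_mult by blast
  ultimately show thesis by (rule that)
qed

end

section \<open>Spectral decompositions\<close>

text \<open>Newton interpolation: a multiple of the product vanishing at the earlier nodes corrects
  the value at the new one. The degree bound is put on coefficients so that \<open>n = 0\<close>
  forces \<open>p = 0\<close>.\<close>

lemma ex_interpolating_poly: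
  fixes x z :: "nat \<Rightarrow> 'f::field"
  assumes "inj_on x {..<n}"
  shows "\<exists>p. (\<forall>i<n. poly p (x i) = z i) \<and> (\<forall>k\<ge>n. coeff p k = 0)"
  using assms
proof (induction n)
  case 0
  show ?case by (intro exI[of _ 0]) simp
next
  case (Suc n)
  then obtain p where p: "\<And>i. i < n \<Longrightarrow> poly p (x i) = z i" "\<And>k. n \<le> k \<Longrightarrow> coeff p k = 0"
    by (auto simp: inj_on_def)
  let ?w = "\<Prod>i<n. [:- x i, 1:]"
  let ?c = "(z n - poly p (x n)) / poly ?w (x n)"
  have w: "degree ?w = n" by (simp add: degree_prod_eq_sum_degree)
  have "x n \<noteq> x i" if "i < n" for i using inj_onD[OF Suc.prems, of n i] that by auto
  then have "poly ?w (x n) \<noteq> 0" by (auto simp: poly_prod)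
  moreover have "poly ?w (x i) = 0" if "i < n" for i using that by (auto simp: poly_prod)
  ultimately show ?case
    using p w by (intro exI[of _ "p + Polynomial.smult ?c ?w"]) (auto simp: less_Suc_eq coeff_eq_0)
qed

text \<open>This is the \<open>P\<close> of the overview.\<close>

definition recurrence_form :: "'f::field \<Rightarrow> 'f \<Rightarrow> 'f \<Rightarrow> 'f \<Rightarrow> 'f \<Rightarrow> 'f" where
  "recurrence_form \<beta> \<gamma> \<rho> x y = x\<^sup>2 + y\<^sup>2 - \<beta> * (x * y) - \<gamma> * (x + y) - \<rho>"

text \<open>These facts stand in for matrices in the arguments on Leonard systems, and serve
  \<open>A\<close> and \<open>As\<close> alike. \<open>rank_one\<close> encodes that
  \<open>E i\<close> is a column times a row, so that \<open>x * E i * y\<close> is a nonzero column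
  times a nonzero row.\<close>

locale spectral_decomposition = field_algebra scale
  for scale :: "'f::field \<Rightarrow> 'a::ring_1 \<Rightarrow> 'a" +
  fixes d :: nat and A :: 'a and \<theta> :: "nat \<Rightarrow> 'f" and E :: "nat \<Rightarrow> 'a"
  assumes inj: "inj_on \<theta> {..d}"
    and A_E: "i \<le> d \<Longrightarrow> A * E i = scale (\<theta> i) (E i)"
    and E_A: "i \<le> d \<Longrightarrow> E i * A = scale (\<theta> i) (E i)"
    and E_idem: "i \<le> d \<Longrightarrow> E i * E i = E i"
    and sum_E: "(\<Sum>i\<le>d. E i) = 1"
    and rank_one: "\<lbrakk>i \<le> d; x * E i \<noteq> 0; E i * y \<noteq> 0\<rbrakk> \<Longrightarrow> x * E i * y \<noteq> 0"
begin

lemma theta_eq_iff: "\<lbrakk>i \<le> d; j \<le> d\<rbrakk> \<Longrightarrow> \<theta> i = \<theta> j \<longleftrightarrow> i = j"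
  using inj by (auto simp: inj_on_def)

text \<open>In \<open>E i * A * E j\<close> the factor \<open>A\<close> can be absorbed on either
  side, and the two eigenvalues differ.\<close>

lemma E_orth:
  assumes "i \<le> d" "j \<le> d" "i \<noteq> j"
  shows "E i * E j = 0"
proof -
  have "scale (\<theta> i) (E i * E j) = E i * A * E j"
    using assms by (simp add: E_A scale_mult_left)
  also have "\<dots> = scale (\<theta> j) (E i * E j)"
    using assms by (simp add: A_E scale_mult_right mult.assoc)
  finally show ?thesis using assms by (auto simp: theta_eq_iff)
qed

lemma pow_E: "i \<le> d \<Longrightarrow> A ^ r * E i = scale (\<theta> i ^ r) (E i)"
proof (induction r)
  case (Suc r)
  have "A ^ Suc r * E i = A ^ r * (A * E i)" by (simp only: power_Suc2 mult.assoc)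
  then show ?case using Suc by (simp add: A_E scale_mult_right mult.commute)
qed simp

lemma poly_at_E: "i \<le> d \<Longrightarrow> poly_at scale p A * E i = scale (poly p (\<theta> i)) (E i)"
  by (simp add: poly_at_def sum_distrib_right scale_mult_left pow_E poly_altdef scale_sum_left)

lemma E_pow: "i \<le> d \<Longrightarrow> E i * A ^ r = scale (\<theta> i ^ r) (E i)"
proof (induction r)
  case (Suc r)
  have "E i * A ^ Suc r = E i * A * A ^ r" by (simp only: power_Suc mult.assoc)
  then show ?case using Suc by (simp add: E_A scale_mult_left)
qed simp

lemma E_poly_at: "i \<le> d \<Longrightarrow> E i * poly_at scale p A = scale (poly p (\<theta> i)) (E i)"
  by (simp add: poly_at_def sum_distrib_left scale_mult_right E_pow poly_altdef scale_sum_left)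

lemma sum_mult_E: "(\<Sum>i\<le>d. x * E i * y) = x * y"
  by (simp flip: sum_distrib_left sum_distrib_right add: sum_E)

lemma eq_0_iff_corners: "X = 0 \<longleftrightarrow> (\<forall>i\<le>d. \<forall>j\<le>d. E i * X * E j = 0)"
proof
  assume *: "\<forall>i\<le>d. \<forall>j\<le>d. E i * X * E j = 0"
  have "E i * X = 0" if "i \<le> d" for i
    using sum_mult_E[of "E i * X" 1] * that by simp
  then show "X = 0" using sum_mult_E[of 1 X] by simp
qed simp

lemma recurrence_parameters:
  assumes "3 \<le> d"
    and P: "\<And>i. i < d \<Longrightarrow> recurrence_form \<beta> \<gamma> \<rho> (\<theta> i) (\<theta> (Suc i)) = 0"
  shows "\<beta> = (\<theta> 0 - \<theta> 3) / (\<theta> 1 - \<theta> 2) - 1"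
    and "\<gamma> = \<theta> 0 - \<beta> * \<theta> 1 + \<theta> 2"
    and "\<rho> = (\<theta> 0)\<^sup>2 + (\<theta> 1)\<^sup>2 - \<beta> * (\<theta> 0 * \<theta> 1) - \<gamma> * (\<theta> 0 + \<theta> 1)"
proof -
  have three: "\<gamma> = \<theta> i - \<beta> * \<theta> (Suc i) + \<theta> (Suc (Suc i))" if "Suc i < d" for i
  proof -
    \<comment> \<open>By symmetry of \<open>P\<close>, the difference
      \<open>P (x, y) - P (y, z)\<close> vanishes at \<open>x = z\<close>; cancelling the nonzero
      factor \<open>x - z\<close> leaves a linear condition.\<close>
    have "(\<theta> i - \<theta> (Suc (Suc i))) * (\<theta> i - \<beta> * \<theta> (Suc i) + \<theta> (Suc (Suc i)) - \<gamma>) =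
        recurrence_form \<beta> \<gamma> \<rho> (\<theta> i) (\<theta> (Suc i)) -
        recurrence_form \<beta> \<gamma> \<rho> (\<theta> (Suc i)) (\<theta> (Suc (Suc i)))"
      by (simp add: recurrence_form_def power2_eq_square algebra_simps)
    also have "\<dots> = 0" using that by (simp add: P)
    finally show ?thesis using that by (simp add: theta_eq_iff)
  qed
  show \<gamma>: "\<gamma> = \<theta> 0 - \<beta> * \<theta> 1 + \<theta> 2"
    using three[of 0] assms(1) by (simp add: numeral_2_eq_2)
  have "\<gamma> = \<theta> 1 - \<beta> * \<theta> 2 + \<theta> 3"
    using three[of 1] assms(1) by (simp add: numeral_2_eq_2 numeral_3_eq_3)
  \<comment> \<open>Equating the expressions for \<gamma> from two consecutive triples eliminates
    it.\<close>
  with \<gamma> have "(\<beta> + 1) * (\<theta> 1 - \<theta> 2) = \<theta> 0 - \<theta> 3" by (simp add: algebra_simps)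
  moreover have "\<theta> 1 \<noteq> \<theta> 2" using assms(1) by (simp add: theta_eq_iff)
  ultimately show "\<beta> = (\<theta> 0 - \<theta> 3) / (\<theta> 1 - \<theta> 2) - 1"
    by (simp add: field_simps)
  show "\<rho> = (\<theta> 0)\<^sup>2 + (\<theta> 1)\<^sup>2 - \<beta> * (\<theta> 0 * \<theta> 1) - \<gamma> * (\<theta> 0 + \<theta> 1)"
    using P[of 0] assms(1) by (simp add: recurrence_form_def)
qed

lemma corner_mult_left: "i \<le> d \<Longrightarrow> E i * (A * Y) * Z = scale (\<theta> i) (E i * Y * Z)"
  by (simp add: E_A scale_mult_left flip: mult.assoc)

lemma corner_mult_right: "j \<le> d \<Longrightarrow> Z * (Y * A) * E j = scale (\<theta> j) (Z * Y * E j)"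
  by (simp add: A_E scale_mult_right mult.assoc)

lemma corner_commutator:
  assumes "i \<le> d" "j \<le> d"
  shows "E i * commutator A Y * E j = scale (\<theta> i - \<theta> j) (E i * Y * E j)"
  using assms by (simp add: commutator_def right_diff_distrib left_diff_distrib
      corner_mult_left corner_mult_right scale_left_diff_distrib)

lemma corner_word:
  assumes "i \<le> d" "j \<le> d"
  shows "E i * (A ^ r * Y * A ^ s) * E j = scale (\<theta> i ^ r * \<theta> j ^ s) (E i * Y * E j)"
proof -
  have "E i * (A ^ r * Y * A ^ s) * E j = (E i * A ^ r) * Y * (A ^ s * E j)"
    by (simp only: mult.assoc)
  then show ?thesis
    using assms by (simp add: E_pow pow_E scale_mult_left scale_mult_right mult.commute)
qed

end

section \<open>Multiplicity-free elements of a matrix algebra\<close>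

text \<open>With the entries as a parameter \<open>M\<close>, a change of basis is just another
  instance of the locale.\<close>

locale matrix_coordinates = field_algebra scale
  for scale :: "'f::field \<Rightarrow> 'a::ring_1 \<Rightarrow> 'a" +
  fixes d :: nat and M :: "'a \<Rightarrow> nat \<Rightarrow> nat \<Rightarrow> 'f"
  assumes M_eqI: "(\<And>i j. \<lbrakk>i \<le> d; j \<le> d\<rbrakk> \<Longrightarrow> M x i j = M y i j) \<Longrightarrow> x = y"
    and M_add: "\<lbrakk>i \<le> d; j \<le> d\<rbrakk> \<Longrightarrow> M (x + y) i j = M x i j + M y i j"
    and M_scale: "\<lbrakk>i \<le> d; j \<le> d\<rbrakk> \<Longrightarrow> M (scale c x) i j = c * M x i j"
    and M_mult: "\<lbrakk>i \<le> d; j \<le> d\<rbrakk> \<Longrightarrow> M (x * y) i j = (\<Sum>k\<le>d. M x i k * M y k j)"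
    and M_1: "\<lbrakk>i \<le> d; j \<le> d\<rbrakk> \<Longrightarrow> M 1 i j = (if i = j then 1 else 0)"
begin

lemma M_0: "\<lbrakk>i \<le> d; j \<le> d\<rbrakk> \<Longrightarrow> M 0 i j = 0"
  using M_scale[of i j 0 0] by simp

lemma M_diff: "\<lbrakk>i \<le> d; j \<le> d\<rbrakk> \<Longrightarrow> M (x - y) i j = M x i j - M y i j"
  using M_add[of i j "x - y" y] by simp

lemma M_sum:
  "\<lbrakk>i \<le> d; j \<le> d\<rbrakk> \<Longrightarrow> M (\<Sum>k\<in>K. f k) i j = (\<Sum>k\<in>K. M (f k) i j)"
  by (induction K rule: infinite_finite_induct) (simp_all add: M_0 M_add)

lemma nonzero_entry:
  assumes "x \<noteq> 0"
  obtains i j where "i \<le> d" "j \<le> d" "M x i j \<noteq> 0"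
  using assms M_eqI[of x 0] M_0 by metis

text \<open>Column \<open>j\<close> of \<open>p\<close> is an eigenvector of every factor
  \<open>f l\<close>, with eigenvalue \<open>g l j\<close>, so the product acts on it by the product
  of these eigenvalues.\<close>

lemma M_prod_list_eigencolumns:
  assumes "\<And>l k j. \<lbrakk>l \<in> set ls; k \<le> d; j \<le> d\<rbrakk> \<Longrightarrow> M (f l * p) k j = M p k j * g l j"
    and "k \<le> d" "j \<le> d"
  shows "M (prod_list (map f ls) * p) k j = M p k j * prod_list (map (\<lambda>l. g l j) ls)"
  using assms
proof (induction ls arbitrary: k)
  case (Cons l ls)
  let ?y = "prod_list (map f ls) * p" and ?c = "prod_list (map (\<lambda>l. g l j) ls)"
  have "M (prod_list (map f (l # ls)) * p) k j = (\<Sum>m\<le>d. M (f l) k m * M ?y m j)"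
    using Cons.prems by (simp add: M_mult mult.assoc)
  also have "\<dots> = (\<Sum>m\<le>d. M (f l) k m * (M p m j * ?c))"
    using Cons by (intro sum.cong) auto
  also have "\<dots> = M (f l * p) k j * ?c"
    unfolding M_mult[OF Cons.prems(2,3)] by (simp add: sum_distrib_right mult.assoc)
  also have "M (f l * p) k j = M p k j * g l j"
    by (rule Cons.prems) (use Cons.prems in auto)
  finally show ?case by (simp add: mult.assoc)
qed simp

text \<open>On an eigencolumn for \<open>\<theta> j\<close> the idempotent acts by a Lagrange basis
  polynomial evaluated at \<open>\<theta> j\<close>: all factors are 1 if \<open>j = i\<close>, and
  otherwise the factor with \<open>l = j\<close> vanishes.\<close>

lemma M_primitive_idempotent_mult:
  assumes "\<And>k j. \<lbrakk>k \<le> d; j \<le> d\<rbrakk> \<Longrightarrow> M (x * p) k j = M p k j * \<theta> j"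
    and "inj_on \<theta> {..d}" "i \<le> d" "k \<le> d" "j \<le> d"
  shows "M (primitive_idempotent scale d x \<theta> i * p) k j = (if j = i then M p k j else 0)"
proof -
  let ?ls = "filter (\<lambda>l. l \<noteq> i) [0..<d + 1]"
  have ls: "set ?ls = {..d} - {i}" by auto
  have "M (primitive_idempotent scale d x \<theta> i * p) k j =
      M p k j * prod_list (map (\<lambda>l. (\<theta> j - \<theta> l) / (\<theta> i - \<theta> l)) ?ls)"
    unfolding primitive_idempotent_def
  proof (rule M_prod_list_eigencolumns)
    fix l k j assume "l \<in> set ?ls" "k \<le> d" "j \<le> d"
    then show "M (scale (1 / (\<theta> i - \<theta> l)) (x - scale (\<theta> l) 1) * p) k j =
        M p k j * ((\<theta> j - \<theta> l) / (\<theta> i - \<theta> l))"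
      using assms(1) by (simp add: scale_mult_left left_diff_distrib M_diff M_scale algebra_simps
          diff_divide_distrib)
  qed (use assms in auto)
  also have "prod_list (map (\<lambda>l. (\<theta> j - \<theta> l) / (\<theta> i - \<theta> l)) ?ls) = (if j = i then 1 else 0)"
  proof (cases "j = i")
    case True
    have "map (\<lambda>l. (\<theta> j - \<theta> l) / (\<theta> i - \<theta> l)) ?ls = map (\<lambda>l. 1) ?ls"
      using assms(2,3) True by (intro map_cong refl) (auto simp del: upt_Suc simp: ls inj_on_def)
    then show ?thesis using True by (simp only: map_replicate_const prod_list_replicate) simp
  next
    case False
    then show ?thesis using assms(5) by (auto simp del: upt_Suc simp: prod_list_zero_iff ls)
  qed
  finally show ?thesis by simp
qed

lemma spectral_decomposition_diagonal:
  assumes x: "\<And>i j. \<lbrakk>i \<le> d; j \<le> d\<rbrakk> \<Longrightarrow> M x i j = (if i = j then \<theta> i else 0)"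
    and inj: "inj_on \<theta> {..d}"
    and E: "\<And>i. i \<le> d \<Longrightarrow> E i = primitive_idempotent scale d x \<theta> i"
  shows "spectral_decomposition scale d x \<theta> E"
proof -
  \<comment> \<open>For \<open>p = 1\<close> the eigencolumns are the unit vectors, so
    \<open>E i\<close> is the matrix unit at \<open>(i, i)\<close>.\<close>
  have M_E: "M (E i) k j = (if k = i \<and> j = i then 1 else 0)" if "i \<le> d" "k \<le> d" "j \<le> d" for i k j
    using M_primitive_idempotent_mult[of x 1 \<theta> i k j] that x inj by (auto simp: M_1 E)
  have M_mult_E: "M (y * E i) k j = (if j = i then M y k i else 0)"
    if "i \<le> d" "k \<le> d" "j \<le> d" for y i k j
    using that by (simp add: M_mult M_E if_distrib[of "(*) _"] sum.If_cases cong: if_cong)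
  have M_E_mult: "M (E i * y) k j = (if k = i then M y i j else 0)"
    if "i \<le> d" "k \<le> d" "j \<le> d" for y i k j
    using that by (simp add: M_mult M_E if_distrib[of "\<lambda>t. t * _"] sum.If_cases cong: if_cong)
  show ?thesis
  proof
    show "inj_on \<theta> {..d}" by (fact inj)
    show "x * E i = scale (\<theta> i) (E i)" if "i \<le> d" for i
      using that by (intro M_eqI) (simp add: M_mult_E x M_scale M_E)
    show "E i * x = scale (\<theta> i) (E i)" if "i \<le> d" for i
      using that by (intro M_eqI) (simp add: M_E_mult x M_scale M_E)
    show "E i * E i = E i" if "i \<le> d" for i
      using that by (intro M_eqI) (simp add: M_E_mult M_E)
    show "(\<Sum>i\<le>d. E i) = 1"
    proof (rule M_eqI)
      fix k j assume kj: "k \<le> d" "j \<le> d"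
      have "M (\<Sum>i\<le>d. E i) k j = (\<Sum>i\<le>d. if k = i then (if j = k then 1 else 0) else 0)"
        unfolding M_sum[OF kj] using kj by (intro sum.cong) (auto simp: M_E)
      then show "M (\<Sum>i\<le>d. E i) k j = M 1 k j" using kj by (simp add: M_1)
    qed
    show "y * E i * z \<noteq> 0" if i: "i \<le> d" and y: "y * E i \<noteq> 0" and z: "E i * z \<noteq> 0" for i y z
    proof -
      from y obtain k j where "k \<le> d" "j \<le> d" "M (y * E i) k j \<noteq> 0" by (rule nonzero_entry)
      with i have k: "k \<le> d" "M y k i \<noteq> 0" by (auto simp: M_mult_E split: if_splits)
      from z obtain m l where "m \<le> d" "l \<le> d" "M (E i * z) m l \<noteq> 0" by (rule nonzero_entry)
      with i have l: "l \<le> d" "M z i l \<noteq> 0" by (auto simp: M_E_mult split: if_splits)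
      \<comment> \<open>\<open>E i\<close> lets only the index \<open>i\<close> through, so this
        entry is a single product of two nonzero scalars.\<close>
      have "M (y * E i * z) k l = M y k i * M z i l"
        using i k l by (simp add: M_mult[of k l] M_mult_E if_distrib[of "\<lambda>t. t * _"]
            sum.If_cases cong: if_cong)
      then show ?thesis using k l by (auto simp: M_0)
    qed
  qed
qed

text \<open>Change of basis: the columns of \<open>p\<close> become the new basis.\<close>

lemma conjugate_coordinates:
  assumes pq: "p * q = 1" "q * p = 1"
  shows "matrix_coordinates scale d (\<lambda>x. M (q * x * p))"
proof
  fix x y
  assume "\<And>i j. \<lbrakk>i \<le> d; j \<le> d\<rbrakk> \<Longrightarrow> M (q * x * p) i j = M (q * y * p) i j"
  then have "q * x * p = q * y * p" by (rule M_eqI)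
  then have "p * (q * x * p) * q = p * (q * y * p) * q" by simp
  then have "(p * q) * x * (p * q) = (p * q) * y * (p * q)" by (simp only: mult.assoc)
  then show "x = y" by (simp add: pq)
next
  fix i j x y assume ij: "i \<le> d" "j \<le> d"
  have "q * (x * y) * p = (q * x) * (p * q) * (y * p)" by (simp add: pq mult.assoc)
  also have "\<dots> = (q * x * p) * (q * y * p)" by (simp only: mult.assoc)
  finally show "M (q * (x * y) * p) i j = (\<Sum>k\<le>d. M (q * x * p) i k * M (q * y * p) k j)"
    using ij by (simp add: M_mult[symmetric])
qed (simp_all add: distrib_left distrib_right M_add M_scale scale_mult_left scale_mult_right pq M_1)

end

context matrix_algebra
begin

text \<open>The second property allows an element to be assembled from chosen columns. The third
  inverts it when the columns are independent, since a zero determinant would give a nonzero kernel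
  vector.\<close>

lemma ex_matrix_coordinates:
  obtains M where "matrix_coordinates scale d M"
    and "\<And>f. \<exists>x. \<forall>i\<le>d. \<forall>j\<le>d. M x i j = f i j"
    and "\<And>x. (\<And>c i. (\<And>k. k \<le> d \<Longrightarrow> (\<Sum>j\<le>d. M x k j * c j) = 0) \<Longrightarrow> i \<le> d \<Longrightarrow> c i = 0)
      \<Longrightarrow> \<exists>y. x * y = 1 \<and> y * x = 1"
proof -
  let ?n = "d + 1"
  from iso_Mat obtain \<phi> :: "'a \<Rightarrow> 'f mat" where
    bij: "bij_betw \<phi> UNIV (carrier_mat ?n ?n)" and one: "\<phi> 1 = 1\<^sub>m ?n"
    and add: "\<And>x y. \<phi> (x + y) = \<phi> x + \<phi> y" and mult: "\<And>x y. \<phi> (x * y) = \<phi> x * \<phi> y"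
    and scl: "\<And>c x. \<phi> (scale c x) = c \<cdot>\<^sub>m \<phi> x" by blast
  have carr: "\<phi> x \<in> carrier_mat ?n ?n" for x using bij by (auto simp: bij_betw_def)
  then have dims [simp]: "dim_row (\<phi> x) = ?n" "dim_col (\<phi> x) = ?n" for x by auto
  have inj: "\<phi> x = \<phi> y \<Longrightarrow> x = y" for x y using bij by (auto simp: bij_betw_def inj_on_def)
  have surj: "\<exists>x. \<phi> x = B" if "B \<in> carrier_mat ?n ?n" for B
    using bij_betw_imp_surj_on[OF bij] that by (metis imageE)
  have atMost: "{..d} = {0..<?n}" by auto
  let ?M = "\<lambda>x i j. \<phi> x $$ (i, j)"
  show thesis
  proof
    show "matrix_coordinates scale d ?M"
    proof
      fix x y assume "\<And>i j. \<lbrakk>i \<le> d; j \<le> d\<rbrakk> \<Longrightarrow> ?M x i j = ?M y i j"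
      then have "\<phi> x = \<phi> y" by (intro eq_matI) auto
      then show "x = y" by (rule inj)
    qed (auto simp: add mult scl one scalar_prod_def atMost intro!: sum.cong)
    show "\<exists>x. \<forall>i\<le>d. \<forall>j\<le>d. ?M x i j = f i j" for f
    proof -
      obtain x where "\<phi> x = mat ?n ?n (\<lambda>(i, j). f i j)" using surj mat_carrier by blast
      then show ?thesis by (intro exI[of _ x]) simp
    qed
    fix x
    assume ker: "\<And>c i. (\<And>k. k \<le> d \<Longrightarrow> (\<Sum>j\<le>d. ?M x k j * c j) = 0) \<Longrightarrow> i \<le> d \<Longrightarrow> c i = 0"
    have "det (\<phi> x) \<noteq> 0"
    proof
      assume "det (\<phi> x) = 0"
      then obtain v where v: "v \<in> carrier_vec ?n" "v \<noteq> 0\<^sub>v ?n" "\<phi> x *\<^sub>v v = 0\<^sub>v ?n"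
        using det_0_iff_vec_prod_zero_field[OF carr] by blast
      have "(\<Sum>j\<le>d. ?M x k j * v $ j) = 0" if "k \<le> d" for k
      proof -
        have "(\<Sum>j\<le>d. ?M x k j * v $ j) = (\<phi> x *\<^sub>v v) $ k"
          using that v(1) by (simp add: scalar_prod_def atMost)
        then show ?thesis using that by (simp add: v(3))
      qed
      then have "v $ i = 0" if "i \<le> d" for i using that by (rule ker)
      then have "v = 0\<^sub>v ?n" using v(1) by (intro eq_vecI) auto
      with v(2) show False ..
    qed
    then have "\<phi> x \<in> Units (ring_mat TYPE('f) ?n ())" by (rule det_non_zero_imp_unit[OF carr])
    then obtain B where B: "B \<in> carrier_mat ?n ?n" "\<phi> x * B = 1\<^sub>m ?n" "B * \<phi> x = 1\<^sub>m ?n"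
      by (auto simp: Units_def ring_mat_simps)
    from surj[OF B(1)] obtain y where "\<phi> y = B" by blast
    with B have "\<phi> (x * y) = \<phi> 1" "\<phi> (y * x) = \<phi> 1" by (simp_all add: mult one)
    then show "\<exists>y. x * y = 1 \<and> y * x = 1" by (blast dest: inj)
  qed
qed

text \<open>Each of the \<open>d + 1\<close> eigenvalues has an eigenvector. The matrix
  \<open>p\<close> with these columns is invertible, and conjugating by it makes \<open>x\<close>
  diagonal.\<close>

lemma spectral_decomposition_primitive_idempotents:
  assumes \<theta>: "bij_betw \<theta> {0..d} (eigenvalues scale x)"
    and E: "\<And>i. i \<le> d \<Longrightarrow> E i = primitive_idempotent scale d x \<theta> i"
  shows "spectral_decomposition scale d x \<theta> E"
proof -
  obtain M where "matrix_coordinates scale d M"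
    and surj: "\<And>f. \<exists>x. \<forall>i\<le>d. \<forall>j\<le>d. M x i j = f i j"
    and unit: "\<And>x. (\<And>c i. (\<And>k. k \<le> d \<Longrightarrow> (\<Sum>j\<le>d. M x k j * c j) = 0) \<Longrightarrow> i \<le> d \<Longrightarrow> c i = 0)
      \<Longrightarrow> \<exists>y. x * y = 1 \<and> y * x = 1"
    using ex_matrix_coordinates by blast
  then interpret matrix_coordinates scale d M by simp
  have inj: "inj_on \<theta> {..d}" using \<theta> by (simp add: bij_betw_def atLeast0AtMost)
  \<comment> \<open>A nonzero column of an element annihilated by
    \<open>x - scale (\<theta> j) 1\<close> is an eigenvector.\<close>
  have "\<exists>v. (\<exists>k\<le>d. v k \<noteq> 0) \<and> (\<forall>k\<le>d. (\<Sum>m\<le>d. M x k m * v m) = v k * \<theta> j)"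
    if "j \<le> d" for j
  proof -
    have "\<theta> j \<in> eigenvalues scale x" using \<theta> that by (auto simp: bij_betw_def)
    then obtain y where y: "y \<noteq> 0" "(x - scale (\<theta> j) 1) * y = 0" by (rule eigenvalue_annihilates)
    then have "x * y = scale (\<theta> j) y" by (simp add: left_diff_distrib scale_mult_left)
    then have "(\<Sum>m\<le>d. M x k m * M y m l) = M y k l * \<theta> j" if "k \<le> d" "l \<le> d" for k l
      using that M_mult[of k l x y] by (simp add: M_scale mult.commute)
    moreover obtain k l where "k \<le> d" "l \<le> d" "M y k l \<noteq> 0" using y(1) by (rule nonzero_entry)
    ultimately show ?thesis by (intro exI[of _ "\<lambda>k. M y k l"]) auto
  qed
  then obtain v where v_nz: "\<And>j. j \<le> d \<Longrightarrow> \<exists>k\<le>d. v j k \<noteq> 0"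
    and v: "\<And>j k. \<lbrakk>j \<le> d; k \<le> d\<rbrakk> \<Longrightarrow> (\<Sum>m\<le>d. M x k m * v j m) = v j k * \<theta> j"
    by metis
  obtain p where p: "\<And>k j. \<lbrakk>k \<le> d; j \<le> d\<rbrakk> \<Longrightarrow> M p k j = v j k"
    using surj[of "\<lambda>k j. v j k"] by blast
  have xp: "M (x * p) k j = M p k j * \<theta> j" if "k \<le> d" "j \<le> d" for k j
    using that v by (simp add: M_mult p)
  have "\<exists>q. p * q = 1 \<and> q * p = 1"
  proof (rule unit)
    fix c i assume c: "\<And>k. k \<le> d \<Longrightarrow> (\<Sum>j\<le>d. M p k j * c j) = 0" and i: "i \<le> d"
    let ?e = "primitive_idempotent scale d x \<theta> i"
    from v_nz[OF i] obtain k where k: "k \<le> d" "v i k \<noteq> 0" by blast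
    \<comment> \<open>Applying the \<open>i\<close>th primitive idempotent to a linear relation
      among the eigencolumns leaves only its \<open>i\<close>th term.\<close>
    have "0 = (\<Sum>l\<le>d. M ?e k l * (\<Sum>j\<le>d. M p l j * c j))" by (simp add: c)
    also have "\<dots> = (\<Sum>j\<le>d. \<Sum>l\<le>d. M ?e k l * M p l j * c j)"
      unfolding sum_distrib_left by (subst sum.swap) (simp add: mult.assoc)
    also have "\<dots> = (\<Sum>j\<le>d. M (?e * p) k j * c j)"
      using k by (simp add: M_mult sum_distrib_right)
    also have "\<dots> = v i k * c i"
      using k i inj by (simp add: M_primitive_idempotent_mult[OF xp] p
          if_distrib[of "\<lambda>t. t * _"] sum.If_cases cong: if_cong)
    finally show "c i = 0" using k by simp
  qed
  then obtain q where pq: "p * q = 1" "q * p = 1" by blast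
  interpret conj: matrix_coordinates scale d "\<lambda>z. M (q * z * p)"
    using pq by (rule conjugate_coordinates)
  show ?thesis
  proof (rule conj.spectral_decomposition_diagonal)
    fix i j assume ij: "i \<le> d" "j \<le> d"
    have "M (q * x * p) i j = M (q * p) i j * \<theta> j"
      using ij by (simp add: mult.assoc M_mult[of i j q] xp sum_distrib_right)
    then show "M (q * x * p) i j = (if i = j then \<theta> i else 0)" using ij by (simp add: pq M_1)
  qed (use inj E in auto)
qed

end

section \<open>Leonard systems\<close>

locale leonard_system =
  L: spectral_decomposition scale d A \<theta> E + R: spectral_decomposition scale d As \<theta>s Es
  for scale :: "'f::field \<Rightarrow> 'a::ring_1 \<Rightarrow> 'a" and d A \<theta> E As \<theta>s Es +
  assumes E_far: "\<lbrakk>i \<le> d; j \<le> d; \<bar>int i - int j\<bar> > 1\<rbrakk> \<Longrightarrow> E i * As * E j = 0"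
    and E_near: "\<lbrakk>i \<le> d; j \<le> d; \<bar>int i - int j\<bar> = 1\<rbrakk> \<Longrightarrow> E i * As * E j \<noteq> 0"
    and Es_far: "\<lbrakk>i \<le> d; j \<le> d; \<bar>int i - int j\<bar> > 1\<rbrakk> \<Longrightarrow> Es i * A * Es j = 0"
    and Es_near: "\<lbrakk>i \<le> d; j \<le> d; \<bar>int i - int j\<bar> = 1\<rbrakk> \<Longrightarrow> Es i * A * Es j \<noteq> 0"
begin

text \<open>The assumptions are symmetric in the two halves, so results about \<theta> transfer to
  \<theta>s.\<close>

lemma dual: "leonard_system scale d As \<theta>s Es A \<theta> E"
  by unfold_locales (auto intro: E_far E_near Es_far Es_near dest: E_near Es_near)

section \<open>Words in \<open>A\<close> between dual idempotents\<close>

text \<open>Each factor \<open>A\<close> moves the index of the dual idempotents by at most one, so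
  \<open>r\<close> factors cannot climb from \<open>j\<close> to \<open>i\<close>.\<close>

lemma Es_pow_vanish:
  assumes "i \<le> d" "j \<le> d" "j + r < i"
  shows "Es i * A ^ r * Es j = 0"
  using assms
proof (induction r arbitrary: i)
  case 0
  then show ?case by (simp add: R.E_orth)
next
  case (Suc r)
  have "Es i * A ^ Suc r * Es j = (\<Sum>k\<le>d. (Es i * A) * Es k * (A ^ r * Es j))"
    by (simp only: R.sum_mult_E) (simp add: mult.assoc)
  also have "\<dots> = (\<Sum>k\<le>d. 0)"
  proof (rule sum.cong)
    fix k assume "k \<in> {..d}"
    then consider "k + 1 < i" | "k \<le> d" "j + r < k" using Suc.prems by fastforce
    then show "(Es i * A) * Es k * (A ^ r * Es j) = 0"
    proof cases
      case 1 then show ?thesis using Suc.prems by (simp add: Es_far)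
    next
      case 2
      have "(Es i * A) * Es k * (A ^ r * Es j) = Es i * A * (Es k * A ^ r * Es j)"
        by (simp only: mult.assoc)
      then show ?thesis using Suc.IH[of k] 2 Suc.prems by simp
    qed
  qed simp
  finally show ?case by simp
qed


text \<open>The only way from 0 to \<open>Suc n\<close> in \<open>Suc n\<close> moves is to climb at
  each one. The contributions of the moves are nonzero, and \<open>rank_one\<close> keeps their
  product nonzero. Starting at exponent 1 makes the base case an instance of
  \<open>Es_near\<close>.\<close>

lemma Es_pow_nonzero:
  assumes "Suc n \<le> d"
  shows "Es (Suc n) * A ^ Suc n * Es 0 \<noteq> 0"
  using assms
proof (induction n)
  case 0
  then show ?case using Es_near[of 1 0] by simp
next
  case (Suc n)
  let ?n = "Suc n"
  have "Es (Suc ?n) * A ^ Suc ?n * Es 0 = (\<Sum>k\<le>d. (Es (Suc ?n) * A) * Es k * (A ^ ?n * Es 0))"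
    by (simp only: R.sum_mult_E) (simp add: mult.assoc)
  also have "\<dots> = (\<Sum>k\<in>{?n}. (Es (Suc ?n) * A) * Es k * (A ^ ?n * Es 0))"
  proof (rule sum.mono_neutral_right)
    show "\<forall>k\<in>{..d} - {?n}. (Es (Suc ?n) * A) * Es k * (A ^ ?n * Es 0) = 0"
    proof
      fix k assume "k \<in> {..d} - {?n}"
      then consider "k \<le> d" "k > ?n" | "k < ?n" by fastforce
      then show "(Es (Suc ?n) * A) * Es k * (A ^ ?n * Es 0) = 0"
      proof cases
        case 1
        then have "Es k * (A ^ ?n * Es 0) = 0"
          using Es_pow_vanish[of k 0 ?n] by (simp add: mult.assoc)
        then show ?thesis by (simp add: mult.assoc)
      next
        case 2
        then show ?thesis using Suc.prems by (simp add: Es_far)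
      qed
    qed
  qed (use Suc.prems in auto)
  also have "\<dots> = Es (Suc ?n) * A * Es ?n * (A ^ ?n * Es 0)" by simp
  also have "\<dots> \<noteq> 0"
  proof (rule R.rank_one)
    show "Es ?n * (A ^ ?n * Es 0) \<noteq> 0" using Suc by (simp add: mult.assoc)
    show "Es (Suc ?n) * A * Es ?n \<noteq> 0" using Suc.prems by (intro Es_near) auto
  qed (use Suc.prems in auto)
  finally show ?case .
qed

text \<open>Insert the sum of the \<open>Es k\<close> after \<open>As\<close>, which then becomes
  \<open>\<theta>s k\<close>. From 0, \<open>A ^ s\<close> reaches only \<open>k \<le> s\<close>,
  while \<open>A ^ r\<close> reaches \<open>n\<close> only from
  \<open>k \<ge> n - r \<ge> s\<close>; hence only \<open>k = s\<close> can contribute.\<close>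

lemma Es_word_Es_0:
  assumes "n \<le> d" "r + s \<le> n"
  shows "Es n * (A ^ r * As * A ^ s) * Es 0 = scale (\<theta>s s) (Es n * A ^ (r + s) * Es 0)"
proof -
  have "Es n * (A ^ r * As * A ^ s) * Es 0 = (\<Sum>k\<le>d. (Es n * A ^ r * As) * Es k * (A ^ s * Es 0))"
    by (simp only: R.sum_mult_E) (simp add: mult.assoc)
  \<comment> \<open>Keeping the vanishing terms, now with the constant factor
    \<open>\<theta>s s\<close>, lets the sum collapse again by \<open>sum_mult_E\<close>.\<close>
  also have "\<dots> = (\<Sum>k\<le>d. scale (\<theta>s s) ((Es n * A ^ r) * Es k * (A ^ s * Es 0)))"
  proof (rule sum.cong)
    fix k assume "k \<in> {..d}"
    then have k: "k \<le> d" by simp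
    have "(Es n * A ^ r * As) * Es k * (A ^ s * Es 0) =
        (Es n * A ^ r) * (As * Es k) * (A ^ s * Es 0)"
      by (simp only: mult.assoc)
    then have "(Es n * A ^ r * As) * Es k * (A ^ s * Es 0) =
        scale (\<theta>s k) ((Es n * A ^ r) * Es k * (A ^ s * Es 0))"
      by (simp only: R.A_E[OF k] L.scale_mult_right L.scale_mult_left)
    moreover have "(Es n * A ^ r) * Es k * (A ^ s * Es 0) = 0" if "k \<noteq> s"
    proof (cases "s < k")
      case True
      then have "Es k * (A ^ s * Es 0) = 0"
        using Es_pow_vanish[of k 0 s] k by (simp add: mult.assoc)
      then show ?thesis by (simp add: mult.assoc)
    next
      case False
      then show ?thesis using Es_pow_vanish[of n k r] assms that k by simp
    qed
    ultimately show "(Es n * A ^ r * As) * Es k * (A ^ s * Es 0) =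
        scale (\<theta>s s) ((Es n * A ^ r) * Es k * (A ^ s * Es 0))"
      by (cases "k = s") auto
  qed simp
  also have "\<dots> = scale (\<theta>s s) (\<Sum>k\<le>d. (Es n * A ^ r) * Es k * (A ^ s * Es 0))"
    by (simp only: L.scale_sum_right)
  finally show ?thesis by (simp only: R.sum_mult_E) (simp add: mult.assoc power_add)
qed

section \<open>The relations as recurrences for the eigenvalues\<close>

text \<open>The corner at \<open>(i, j)\<close> is \<open>E i * As * E j\<close> scaled by
  \<open>(\<theta> i - \<theta> j) * P (\<theta> i, \<theta> j)\<close>. It vanishes for
  \<open>i = j\<close>, and for \<open>|i - j| > 1\<close> by tridiagonality. For neighbours
  \<open>P\<close> must vanish, and symmetry of \<open>P\<close> reduces these to
  \<open>j = i + 1\<close>.\<close>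

lemma commutator_eq_0_iff:
  "commutator A (A^2 * As - scale \<beta> (A * As * A) + As * A^2
      - scale \<gamma> (A * As + As * A) - scale \<rho> As) = 0 \<longleftrightarrow>
    (\<forall>i<d. recurrence_form \<beta> \<gamma> \<rho> (\<theta> i) (\<theta> (Suc i)) = 0)" (is "commutator A ?Y = 0 \<longleftrightarrow> _")
proof -
  have corner: "E i * commutator A ?Y * E j =
      scale ((\<theta> i - \<theta> j) * recurrence_form \<beta> \<gamma> \<rho> (\<theta> i) (\<theta> j)) (E i * As * E j)"
    if ij: "i \<le> d" "j \<le> d" for i j
  proof -
    have "E i * commutator A ?Y * E j = scale (\<theta> i - \<theta> j) (E i * ?Y * E j)"
      using ij by (rule L.corner_commutator)
    also have "E i * ?Y * E j = scale (recurrence_form \<beta> \<gamma> \<rho> (\<theta> i) (\<theta> j)) (E i * As * E j)"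
    proof -
      have "E i * (A^2 * As) * E j = scale ((\<theta> i)\<^sup>2) (E i * As * E j)"
        using ij by (simp add: L.E_pow L.scale_mult_left flip: mult.assoc)
      moreover have "E i * (As * A^2) * E j = scale ((\<theta> j)\<^sup>2) (E i * As * E j)"
        using ij by (simp add: L.pow_E L.scale_mult_right mult.assoc)
      moreover have "E i * (A * As * A) * E j = scale (\<theta> i * \<theta> j) (E i * As * E j)"
        using ij by (simp add: L.corner_mult_left L.corner_mult_right mult.commute)
      moreover have "E i * (A * As) * E j = scale (\<theta> i) (E i * As * E j)"
        using ij by (simp add: L.corner_mult_left)
      moreover have "E i * (As * A) * E j = scale (\<theta> j) (E i * As * E j)"
        using ij by (simp add: L.corner_mult_right)
      ultimately show ?thesis
        unfolding recurrence_form_def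
        by (simp only: right_diff_distrib left_diff_distrib distrib_left distrib_right
            L.scale_mult_left L.scale_mult_right L.scale_left_diff_distrib L.scale_left_distrib
            L.scale_right_distrib L.scale_scale mult.assoc diff_add_eq)
    qed
    finally show ?thesis by simp
  qed
  show ?thesis
  proof
    assume *: "commutator A ?Y = 0"
    show "\<forall>i<d. recurrence_form \<beta> \<gamma> \<rho> (\<theta> i) (\<theta> (Suc i)) = 0"
    proof (intro allI impI)
      fix i assume "i < d"
      then have i: "i \<le> d" "Suc i \<le> d" by auto
      have "scale ((\<theta> i - \<theta> (Suc i)) * recurrence_form \<beta> \<gamma> \<rho> (\<theta> i) (\<theta> (Suc i)))
          (E i * As * E (Suc i)) = 0"
        unfolding corner[OF i, symmetric] * by simp
      then show "recurrence_form \<beta> \<gamma> \<rho> (\<theta> i) (\<theta> (Suc i)) = 0"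
        using E_near[OF i] by (simp add: L.theta_eq_iff i)
    qed
  next
    assume *: "\<forall>i<d. recurrence_form \<beta> \<gamma> \<rho> (\<theta> i) (\<theta> (Suc i)) = 0"
    have sym: "recurrence_form \<beta> \<gamma> \<rho> x y = recurrence_form \<beta> \<gamma> \<rho> y x" for x y
      by (simp add: recurrence_form_def ac_simps)
    show "commutator A ?Y = 0"
      proof (rule L.eq_0_iff_corners[THEN iffD2], intro allI impI)
      fix i j assume ij: "i \<le> d" "j \<le> d"
      consider "i = j" | "j = Suc i" | "i = Suc j" | "\<bar>int i - int j\<bar> > 1" by linarith
      then have "i = j \<or> recurrence_form \<beta> \<gamma> \<rho> (\<theta> i) (\<theta> j) = 0 \<or> E i * As * E j = 0"
      proof cases
        case 2 then show ?thesis using ij(2) * by simp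
      next
        case 3
        then have "recurrence_form \<beta> \<gamma> \<rho> (\<theta> j) (\<theta> i) = 0" using ij(1) * by simp
        then show ?thesis by (subst sym) simp
      next
        case 4 then show ?thesis using ij by (simp add: E_far)
      qed simp
      then show "E i * commutator A ?Y * E j = 0"
        unfolding corner[OF ij] by auto
    qed
  qed
qed

text \<open>Here \<beta> is expressed through the dual eigenvalues; comparison with
  \<open>recurrence_parameters\<close> will identify it with the expression in \<theta>.\<close>

lemma ex_recurrence:
  assumes d: "3 \<le> d"
  obtains \<gamma> \<rho> where
    "\<And>i. i < d \<Longrightarrow>
      recurrence_form ((\<theta>s 0 - \<theta>s 3) / (\<theta>s 1 - \<theta>s 2) - 1) \<gamma> \<rho> (\<theta> i) (\<theta> (Suc i)) = 0"
proof -
  \<comment> \<open>The values \<open>p(\<theta>\<^sub>i)\<close> are forced, up to a constant, by comparing the corners with \<open>j = i + 1\<close>.\<close>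
  define z where "z i = - (\<Sum>k<i. \<theta> k * \<theta> (Suc k) * (\<theta> k - \<theta> (Suc k)))" for i
  have z: "z i - z (Suc i) = \<theta> i * \<theta> (Suc i) * (\<theta> i - \<theta> (Suc i))" for i by (simp add: z_def)
  have "inj_on \<theta> {..<Suc d}" using L.inj by (simp add: lessThan_Suc_atMost)
  from ex_interpolating_poly[OF this, of z] obtain p where
    "\<forall>i<Suc d. poly p (\<theta> i) = z i" "\<forall>k\<ge>Suc d. coeff p k = 0"
    by blast
  then have p: "\<And>i. i \<le> d \<Longrightarrow> poly p (\<theta> i) = z i" "\<And>k. d < k \<Longrightarrow> coeff p k = 0"
    by (simp_all only: less_Suc_eq_le Suc_le_eq)
  let ?Z = "poly_at scale p A"
  have word: "E i * (A^2 * As * A^1 - A^1 * As * A^2 - (?Z * As - As * ?Z)) * E j =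
      scale (\<theta> i * \<theta> j * (\<theta> i - \<theta> j) - (z i - z j)) (E i * As * E j)"
    if "i \<le> d" "j \<le> d" for i j
  proof -
    note L.corner_word[OF that, of 2 As 1] L.corner_word[OF that, of 1 As 2]
    moreover have "E i * (?Z * As) * E j = scale (z i) (E i * As * E j)"
      using that by (simp add: L.E_poly_at L.scale_mult_left p flip: mult.assoc)
    moreover have "E i * (As * ?Z) * E j = scale (z j) (E i * As * E j)"
      using that by (simp add: L.poly_at_E L.scale_mult_right p mult.assoc)
    ultimately show ?thesis
      by (simp only: right_diff_distrib left_diff_distrib L.scale_left_diff_distrib)
        (simp add: power2_eq_square ac_simps)
  qed
  \<comment> \<open>Diagonal corners cancel, neighbouring ones agree by the choice of
    \<open>z\<close> (both sides are antisymmetric in \<open>i\<close> and \<open>j\<close>), and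
    for the others \<open>E i * As * E j\<close> is zero.\<close>
  have "A^2 * As * A^1 - A^1 * As * A^2 - (?Z * As - As * ?Z) = 0"
    proof (rule L.eq_0_iff_corners[THEN iffD2], intro allI impI)
    fix i j assume ij: "i \<le> d" "j \<le> d"
    consider "i = j" | "j = Suc i" | "i = Suc j" | "\<bar>int i - int j\<bar> > 1" by linarith
    then have "\<theta> i * \<theta> j * (\<theta> i - \<theta> j) = z i - z j \<or> E i * As * E j = 0"
    proof cases
      case 3
      then show ?thesis using z[of j] by (simp add: algebra_simps)
    qed (use ij z in \<open>simp_all add: E_far\<close>)
    then show "E i * (A^2 * As * A^1 - A^1 * As * A^2 - (?Z * As - As * ?Z)) * E j = 0"
      unfolding word[OF ij] by auto
  qed
  then have key: "A^2 * As * A^1 - A^1 * As * A^2 = ?Z * As - As * ?Z" by simp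
  \<comment> \<open>Between \<open>Es n\<close> and \<open>Es 0\<close> only the term of degree
    \<open>n\<close> of \<open>p\<close> survives, and \<open>As\<close> acts by
    \<open>\<theta>s 0\<close> on the right and by \<open>\<theta>s n\<close> on the left.\<close>
  have lead: "scale (coeff p n * (\<theta>s 0 - \<theta>s n)) (Es n * A ^ n * Es 0) =
      Es n * (A^2 * As * A^1) * Es 0 - Es n * (A^1 * As * A^2) * Es 0"
    if n: "n \<le> d" "degree p \<le> n" for n
  proof -
    have "Es n * ?Z * Es 0 = (\<Sum>i\<le>n. scale (coeff p i) (Es n * A ^ i * Es 0))"
      by (simp add: L.poly_at_eq_sum[OF n(2)] sum_distrib_left sum_distrib_right
          L.scale_mult_left L.scale_mult_right)
    also have "\<dots> = (\<Sum>i\<in>{n}. scale (coeff p i) (Es n * A ^ i * Es 0))"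
      using n(1) by (intro sum.mono_neutral_right) (auto simp: Es_pow_vanish)
    finally have Z: "Es n * ?Z * Es 0 = scale (coeff p n) (Es n * A ^ n * Es 0)" by simp
    have "Es n * (A^2 * As * A^1) * Es 0 - Es n * (A^1 * As * A^2) * Es 0 =
        Es n * (?Z * As) * Es 0 - Es n * (As * ?Z) * Es 0"
      using key by (simp only: flip: right_diff_distrib left_diff_distrib)
    also have "\<dots> = scale (\<theta>s 0 - \<theta>s n) (Es n * ?Z * Es 0)"
      using n(1) by (simp add: R.corner_mult_left R.corner_mult_right L.scale_left_diff_distrib)
    finally show ?thesis by (simp add: Z mult.commute)
  qed
  \<comment> \<open>If \<open>n = degree p\<close> exceeds 3, words with three factors
    \<open>A\<close> cannot climb from 0 to \<open>n\<close>, so the right side of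
    \<open>lead\<close> is zero while its left side is not.\<close>
  have deg: "degree p \<le> 3"
  proof (rule ccontr)
    assume *: "\<not> degree p \<le> 3"
    then have nz: "coeff p (degree p) \<noteq> 0" by (auto simp: leading_coeff_0_iff)
    then have n: "degree p \<le> d" using p(2) by (meson not_le)
    obtain m where m: "degree p = Suc m" using * by (cases "degree p") auto
    have "Es (degree p) * A ^ degree p * Es 0 \<noteq> 0" using n unfolding m by (rule Es_pow_nonzero)
    moreover have word_0: "Es (degree p) * (A ^ r * As * A ^ s) * Es 0 = 0" if "r + s = 3" for r s
      using n * that Es_word_Es_0[of "degree p" r s] Es_pow_vanish[of "degree p" 0 "r + s"] by simp
    ultimately show False
      using lead[OF n order_refl] word_0[of 2 1] word_0[of 1 2] nz n * by (simp add: R.theta_eq_iff)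
  qed
  have word_3: "Es 3 * (A ^ r * As * A ^ s) * Es 0 = scale (\<theta>s s) (Es 3 * A ^ 3 * Es 0)"
    if "r + s = 3" for r s
    using Es_word_Es_0[OF d, of r s] that by simp
  \<comment> \<open>At \<open>n = 3\<close> the two words contribute \<open>\<theta>s 1\<close> and
    \<open>\<theta>s 2\<close>, the exponents of \<open>A\<close> to the right of \<open>As\<close>
    being 1 and 2.\<close>
  have "scale (coeff p 3 * (\<theta>s 0 - \<theta>s 3)) (Es 3 * A ^ 3 * Es 0) =
      scale (\<theta>s 1 - \<theta>s 2) (Es 3 * A ^ 3 * Es 0)"
    using lead[OF d deg] word_3[of 2 1] word_3[of 1 2] by (simp add: L.scale_left_diff_distrib)
  moreover have "Es 3 * A ^ 3 * Es 0 \<noteq> 0" using Es_pow_nonzero[of 2] d by (simp add: numeral_3_eq_3)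
  ultimately have c3: "coeff p 3 * (\<theta>s 0 - \<theta>s 3) = \<theta>s 1 - \<theta>s 2" by simp
  have nz: "\<theta>s 1 - \<theta>s 2 \<noteq> 0" using d by (simp add: R.theta_eq_iff)
  with c3 have c3_nz: "coeff p 3 \<noteq> 0" by auto
  with c3 nz have b: "(\<theta>s 0 - \<theta>s 3) / (\<theta>s 1 - \<theta>s 2) = 1 / coeff p 3"
    by (simp add: frac_eq_eq mult.commute)
  have poly_p: "poly p x = coeff p 0 + coeff p 1 * x + coeff p 2 * x^2 + coeff p 3 * x^3" for x
  proof -
    have "poly p x = (\<Sum>i\<le>3. coeff p i * x ^ i)"
      unfolding poly_altdef using deg by (intro sum.mono_neutral_left) (auto simp: coeff_eq_0)
    then show ?thesis by (simp add: eval_nat_numeral)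
  qed
  show thesis
  proof (rule that)
    fix i assume i: "i < d"
    let ?x = "\<theta> i" and ?y = "\<theta> (Suc i)"
    \<comment> \<open>Cancel \<open>?x - ?y\<close> from \<open>p(x) - p(y) = x y (x - y)\<close>
      and divide by \<open>coeff p 3\<close>: the coefficient of \<open>x y\<close> gives
      \<open>\<beta> = 1 / coeff p 3 - 1\<close>, and the lower coefficients give \<gamma> and
      \<rho>.\<close>
    have "(?x - ?y) *
          (coeff p 1 + coeff p 2 * (?x + ?y) + coeff p 3 * (?x^2 + ?x * ?y + ?y^2) - ?x * ?y)
        = poly p ?x - poly p ?y - ?x * ?y * (?x - ?y)"
      by (simp add: poly_p power2_eq_square power3_eq_cube algebra_simps)
    also have "\<dots> = 0" using i z[of i] by (simp add: p)
    finally have "coeff p 1 + coeff p 2 * (?x + ?y) + coeff p 3 * (?x^2 + ?x * ?y + ?y^2) = ?x * ?y"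
      using i by (simp add: L.theta_eq_iff)
    then show "recurrence_form ((\<theta>s 0 - \<theta>s 3) / (\<theta>s 1 - \<theta>s 2) - 1)
        (- (coeff p 2 / coeff p 3)) (- (coeff p 1 / coeff p 3)) ?x ?y = 0"
      using c3_nz unfolding b recurrence_form_def
      by (simp add: divide_simps) (simp add: algebra_simps)
  qed
qed

lemma ex_recurrence_small:
  assumes "d < 3"
  obtains \<gamma> \<rho> where "\<And>i. i < d \<Longrightarrow> recurrence_form (- 1) \<gamma> \<rho> (\<theta> i) (\<theta> (Suc i)) = 0"
proof (rule that)
  \<comment> \<open>The form below is the divided difference of the cubic with roots \<open>\<theta>\<^sub>0, \<theta>\<^sub>1, \<theta>\<^sub>2\<close>. If \<open>d < 2\<close>
    some of these lie outside the spectrum and are arbitrary scalars.\<close>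
  fix i assume "i < d"
  with assms have "i = 0 \<or> i = 1" by auto
  then show "recurrence_form (- 1) (\<theta> 0 + \<theta> 1 + \<theta> 2)
      (- (\<theta> 0 * \<theta> 1 + \<theta> 0 * \<theta> 2 + \<theta> 1 * \<theta> 2)) (\<theta> i) (\<theta> (Suc i)) = 0"
    by (auto simp: recurrence_form_def power2_eq_square algebra_simps numeral_2_eq_2)
qed

end

section \<open>Coupling the two relations through a common \<beta>\<close>

theorem theorem1p12:
  fixes scale :: "'f::field \<Rightarrow> 'a::ring_1 \<Rightarrow> 'a"
    and d :: nat
    and A As :: 'a
  assumes "matrix_algebra scale d"
    and "leonard_pair scale d A As"
  shows "(\<exists>\<beta> \<gamma> \<gamma>s \<rho> \<rho>s. tridiagonal_relations scale A As \<beta> \<gamma> \<gamma>s \<rho> \<rho>s) \<and>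
    (d \<ge> 3 \<longrightarrow>
      (\<exists>!(\<beta>, \<gamma>, \<gamma>s, \<rho>, \<rho>s). tridiagonal_relations scale A As \<beta> \<gamma> \<gamma>s \<rho> \<rho>s))"
proof -
  interpret matrix_algebra scale d by fact
  obtain E Es \<theta> \<theta>s where \<theta>: "bij_betw \<theta> {0..d} (eigenvalues scale A)"
      "\<And>i. i \<le> d \<Longrightarrow> E i = primitive_idempotent scale d A \<theta> i"
    and \<theta>s: "bij_betw \<theta>s {0..d} (eigenvalues scale As)"
      "\<And>i. i \<le> d \<Longrightarrow> Es i = primitive_idempotent scale d As \<theta>s i"
    and tri: "\<And>i j. \<lbrakk>i \<le> d; j \<le> d\<rbrakk> \<Longrightarrow>
      (\<bar>int i - int j\<bar> > 1 \<longrightarrow> E i * As * E j = 0 \<and> Es i * A * Es j = 0) \<and>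
      (\<bar>int i - int j\<bar> = 1 \<longrightarrow> E i * As * E j \<noteq> 0 \<and> Es i * A * Es j \<noteq> 0)"
    using assms(2) unfolding leonard_pair_def primitive_idempotent_ordering_def by blast
  interpret S: spectral_decomposition scale d A \<theta> E
    using \<theta> by (rule spectral_decomposition_primitive_idempotents)
  interpret Ss: spectral_decomposition scale d As \<theta>s Es
    using \<theta>s by (rule spectral_decomposition_primitive_idempotents)
  interpret L: leonard_system scale d A \<theta> E As \<theta>s Es
    by unfold_locales (use tri in blast)+
  interpret Ls: leonard_system scale d As \<theta>s Es A \<theta> E by (rule L.dual)
  \<comment> \<open>The relations separate into one condition on \<theta> and one on \<theta>s,
    linked only by \<beta>.\<close>
  have relations_iff: "tridiagonal_relations scale A As \<beta> \<gamma> \<gamma>s \<rho> \<rho>s \<longleftrightarrow>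
      (\<forall>i<d. recurrence_form \<beta> \<gamma> \<rho> (\<theta> i) (\<theta> (Suc i)) = 0) \<and>
      (\<forall>i<d. recurrence_form \<beta> \<gamma>s \<rho>s (\<theta>s i) (\<theta>s (Suc i)) = 0)" for \<beta> \<gamma> \<gamma>s \<rho> \<rho>s
    unfolding tridiagonal_relations_def L.commutator_eq_0_iff[symmetric]
      Ls.commutator_eq_0_iff[symmetric] by (simp only: eq_commute[of 0])
  have ex: "\<exists>\<beta> \<gamma> \<gamma>s \<rho> \<rho>s. tridiagonal_relations scale A As \<beta> \<gamma> \<gamma>s \<rho> \<rho>s"
  proof (cases "3 \<le> d")
    case True
    obtain \<gamma> \<rho> where g: "\<And>i. i < d \<Longrightarrow>
        recurrence_form ((\<theta>s 0 - \<theta>s 3) / (\<theta>s 1 - \<theta>s 2) - 1) \<gamma> \<rho> (\<theta> i) (\<theta> (Suc i)) = 0"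
      using L.ex_recurrence[OF True] by blast
    obtain \<gamma>s \<rho>s where gs: "\<And>i. i < d \<Longrightarrow>
        recurrence_form ((\<theta> 0 - \<theta> 3) / (\<theta> 1 - \<theta> 2) - 1) \<gamma>s \<rho>s (\<theta>s i) (\<theta>s (Suc i)) = 0"
      using Ls.ex_recurrence[OF True] by blast
    \<comment> \<open>The recurrence \<open>g\<close> along \<theta> forces its \<beta>, built from
      \<theta>s, to equal the expression in \<theta>, which is the \<beta> of
      \<open>gs\<close>.\<close>
    show ?thesis
      unfolding relations_iff using g gs S.recurrence_parameters(1)[OF True g] by metis
  next
    case False
    then have "d < 3" by simp
    \<comment> \<open>The value \<open>- 1\<close> does not depend on the eigenvalues, so it serves
      both sequences at once.\<close>
    obtain \<gamma> \<rho> where "\<And>i. i < d \<Longrightarrow> recurrence_form (- 1) \<gamma> \<rho> (\<theta> i) (\<theta> (Suc i)) = 0"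
      using L.ex_recurrence_small[OF \<open>d < 3\<close>] by blast
    moreover obtain \<gamma>s \<rho>s where
      "\<And>i. i < d \<Longrightarrow> recurrence_form (- 1) \<gamma>s \<rho>s (\<theta>s i) (\<theta>s (Suc i)) = 0"
      using Ls.ex_recurrence_small[OF \<open>d < 3\<close>] by blast
    ultimately show ?thesis unfolding relations_iff by blast
  qed
  moreover have "\<exists>!(\<beta>, \<gamma>, \<gamma>s, \<rho>, \<rho>s). tridiagonal_relations scale A As \<beta> \<gamma> \<gamma>s \<rho> \<rho>s" if d: "3 \<le> d"
  proof -
    \<comment> \<open>Each parameter equals a fixed expression in the eigenvalues and the parameters
      already determined, starting with \<beta>.\<close>
    have unique: "\<beta> = \<beta>' \<and> \<gamma> = \<gamma>' \<and> \<gamma>s = \<gamma>s' \<and> \<rho> = \<rho>' \<and> \<rho>s = \<rho>s'"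
      if "tridiagonal_relations scale A As \<beta> \<gamma> \<gamma>s \<rho> \<rho>s"
        and "tridiagonal_relations scale A As \<beta>' \<gamma>' \<gamma>s' \<rho>' \<rho>s'"
      for \<beta> \<gamma> \<gamma>s \<rho> \<rho>s \<beta>' \<gamma>' \<gamma>s' \<rho>' \<rho>s'
      using that S.recurrence_parameters[OF d, of \<beta> \<gamma> \<rho>] S.recurrence_parameters[OF d, of \<beta>' \<gamma>' \<rho>']
        Ss.recurrence_parameters[OF d, of \<beta> \<gamma>s \<rho>s] Ss.recurrence_parameters[OF d, of \<beta>' \<gamma>s' \<rho>s']
      unfolding relations_iff by metis
    obtain \<beta> \<gamma> \<gamma>s \<rho> \<rho>s where rel: "tridiagonal_relations scale A As \<beta> \<gamma> \<gamma>s \<rho> \<rho>s" using ex by blast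
    then show ?thesis
      by (intro ex1I[of _ "(\<beta>, \<gamma>, \<gamma>s, \<rho>, \<rho>s)"]) (auto simp: rel dest: unique[OF rel])
  qed
  ultimately show ?thesis by blast
qed

end
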